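(* There exists an absolute constant $c>0$ such that for all $m,n\in\mathbb{N}$, with $N=mn$, and all $q\in[1,2]$, $$d_{\lfloor N/2\rfloor}\bigl(V_m^N,\ell_q^N\bigr)\ge c\,m^{1/q},$$ where $V_m^N=B_\infty^N\cap mB_1^N$.
   Context: $\ell_q^N$ is $\mathbb{R}^N$ with the usual $\ell_q$ norm, and $B_p^N$ is the closed unit ball of $\ell_p^N$. Thus $V_m^N=\{x\in\mathbb{R}^N:\ \max_i|x_i|\le 1,\ \sum_i|x_i|\le m\}$ (the generalized octahedron). The Kolmogorov width of a subset $M$ of a normed space $X$ is $$d_k(M,X)=\inf_{\substack{L\subset X\\ \dim L\le k}}\ \sup_{x\in M}\ \inf_{y\in L}\|x-y\|_X,$$ where $L$ ranges over linear subspaces of $X$. *)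

theory Defs
  imports "HOL-Analysis.Analysis" "HOL-Library.Function_Algebras"
begin

text \<open>
  The dimension \<open>N\<close> is a variable of the formulas below, so \<open>\<real>\<^sup>N\<close> is the linear subspace of those
  \<open>x :: nat \<Rightarrow> real\<close> that vanish outside \<open>{..<N}\<close>.  The pointwise vector space structure makes
  \<^const>\<open>subspace\<close>, \<^const>\<open>span\<close> and \<^const>\<open>dim\<close> available for sets of such functions.
\<close>

instantiation "fun" :: (type, real_vector) real_vector
begin

definition scaleR_fun :: "real \<Rightarrow> ('a \<Rightarrow> 'b) \<Rightarrow> 'a \<Rightarrow> 'b"
  where "scaleR_fun c f = (\<lambda>i. c *\<^sub>R f i)"

instance
  by standard (simp_all add: scaleR_fun_def fun_eq_iff scaleR_add_right scaleR_add_left)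

end

definition coord_space :: "nat \<Rightarrow> (nat \<Rightarrow> real) set"
  where "coord_space N = {x. \<forall>i\<ge>N. x i = 0}"

text \<open>The inserted \<open>0\<close> only matters for \<open>N = 0\<close>, where the maximum would be over the empty set.\<close>

definition lp_norm :: "ereal \<Rightarrow> nat \<Rightarrow> (nat \<Rightarrow> real) \<Rightarrow> real"
  where "lp_norm p N x =
    (if p = \<infinity> then Max (insert 0 ((\<lambda>i. \<bar>x i\<bar>) ` {..<N}))
     else (\<Sum>i<N. \<bar>x i\<bar> powr real_of_ereal p) powr (1 / real_of_ereal p))"

definition lp_ball :: "ereal \<Rightarrow> nat \<Rightarrow> (nat \<Rightarrow> real) set"
  where "lp_ball p N = {x \<in> coord_space N. lp_norm p N x \<le> 1}"

definition octahedron :: "nat \<Rightarrow> nat \<Rightarrow> (nat \<Rightarrow> real) set"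
  where "octahedron m N = lp_ball \<infinity> N \<inter> (\<lambda>x. real m *\<^sub>R x) ` lp_ball 1 N"

text \<open>
  The normed space is given by a carrier \<open>X\<close>, a linear subspace of the ambient type, and a norm \<open>\<nu>\<close>
  on it.  Since \<^const>\<open>dim\<close> is \<open>0\<close> on infinite-dimensional subspaces, finite dimension is required
  separately.  Values are extended reals, so no infimum or supremum is a default value.
\<close>

definition kolmogorov_width ::
    "nat \<Rightarrow> 'a::real_vector set \<Rightarrow> 'a set \<Rightarrow> ('a \<Rightarrow> real) \<Rightarrow> ereal"
  where "kolmogorov_width k M X \<nu> =
    (INF L \<in> {L. subspace L \<and> L \<subseteq> X \<and> (\<exists>B. finite B \<and> L = span B) \<and> dim L \<le> k}.
      SUP x \<in> M. INF y \<in> L. ereal (\<nu> (x - y)))"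

lemma octahedron_eq:
  "octahedron m N =
     {x \<in> coord_space N. (\<forall>i<N. \<bar>x i\<bar> \<le> 1) \<and> (\<Sum>i<N. \<bar>x i\<bar>) \<le> real m}"
proof -
  have inf: "x \<in> lp_ball \<infinity> N \<longleftrightarrow> x \<in> coord_space N \<and> (\<forall>i<N. \<bar>x i\<bar> \<le> 1)" for x
    by (auto simp: lp_ball_def lp_norm_def)
  have one: "x \<in> lp_ball 1 N \<longleftrightarrow> x \<in> coord_space N \<and> (\<Sum>i<N. \<bar>x i\<bar>) \<le> 1" for x
    by (simp add: lp_ball_def lp_norm_def sum_nonneg)
  have scale: "x \<in> (\<lambda>x. real m *\<^sub>R x) ` lp_ball 1 N
      \<longleftrightarrow> x \<in> coord_space N \<and> (\<Sum>i<N. \<bar>x i\<bar>) \<le> real m" for x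
  proof
    assume "x \<in> (\<lambda>x. real m *\<^sub>R x) ` lp_ball 1 N"
    then obtain y where y: "y \<in> coord_space N" "(\<Sum>i<N. \<bar>y i\<bar>) \<le> 1" "x = real m *\<^sub>R y"
      by (auto simp: one)
    have "(\<Sum>i<N. \<bar>x i\<bar>) = real m * (\<Sum>i<N. \<bar>y i\<bar>)"
      by (simp add: y(3) scaleR_fun_def abs_mult sum_distrib_left)
    also have "\<dots> \<le> real m * 1"
      using y(2) by (intro mult_left_mono) auto
    finally show "x \<in> coord_space N \<and> (\<Sum>i<N. \<bar>x i\<bar>) \<le> real m"
      using y(1) by (simp add: y(3) scaleR_fun_def coord_space_def)
  next
    assume x: "x \<in> coord_space N \<and> (\<Sum>i<N. \<bar>x i\<bar>) \<le> real m"
    show "x \<in> (\<lambda>x. real m *\<^sub>R x) ` lp_ball 1 N"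
    proof (cases "m = 0")
      case True
      then have "(\<Sum>i<N. \<bar>x i\<bar>) = 0"
        using x by (intro antisym) (auto intro: sum_nonneg)
      then have "x i = 0" for i
        using x by (cases "i < N") (auto simp: sum_nonneg_eq_0_iff coord_space_def)
      then have "x = real m *\<^sub>R 0"
        by (simp add: fun_eq_iff)
      moreover have "(0 :: nat \<Rightarrow> real) \<in> lp_ball 1 N"
        by (simp add: one coord_space_def)
      ultimately show ?thesis by blast
    next
      case False
      let ?y = "(1 / real m) *\<^sub>R x"
      have "(\<Sum>i<N. \<bar>?y i\<bar>) = (\<Sum>i<N. \<bar>x i\<bar>) / real m"
        by (simp add: scaleR_fun_def abs_mult sum_divide_distrib)
      then have "?y \<in> lp_ball 1 N"
        using x False by (auto simp: one coord_space_def scaleR_fun_def)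
      moreover have "x = real m *\<^sub>R ?y"
        using False by simp
      ultimately show ?thesis by blast
    qed
  qed
  show ?thesis
    unfolding octahedron_def set_eq_iff Int_iff inf scale by auto
qed

end

theory Submission
  imports Defs
begin

text \<open>
  Let \<open>W\<close> be the orthogonal complement of the approximating subspace \<open>L\<close>, and let \<open>b\<close> be a block of
  \<open>m\<close> coordinates whose unit vectors have, on average, squared distance at least \<open>1/2\<close> to \<open>L\<close>.
  Maximise the indefinite form \<open>\<Phi> z = 4 (\<Sum>i\<in>b. (z i)\<^sup>2) - (\<Sum>i<N. (z i)\<^sup>2)\<close> over \<open>z \<in> W\<close> with
  \<open>\<bar>z i\<bar> \<le> 1\<close>.  As \<open>\<Phi> z \<ge> 0\<close>, the mass of \<open>z\<close> is at most four times its mass \<open>s\<close> on \<open>b\<close>.  If \<open>s < m/16\<close>,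
  fewer than \<open>m/4\<close> coordinates of \<open>z\<close> are \<open>\<plusminus>1\<close>; imposing that these do not move still leaves some
  unit vector \<open>e\<^sub>i\<close>, \<open>i \<in> b\<close>, whose projection \<open>w\<close> to the remaining directions has squared norm
  \<open>> 1/4\<close>, so \<open>\<Phi> w > 0\<close> and one of \<open>z \<plusminus> t w\<close> beats \<open>z\<close>.  Hence \<open>s \<ge> m/16\<close>, and \<open>z\<close> is a dual
  certificate: its sign pattern on \<open>b\<close> lies in the octahedron and is far from \<open>L\<close> for all
  \<open>q \<in> [1, 2]\<close> simultaneously, because \<open>z\<close> is controlled in both \<open>\<ell>\<^sub>2\<close> and \<open>\<ell>\<^sub>\<infinity>\<close>.
\<close>

section \<open>Inner product on the coordinate space\<close>

definition ip :: "nat \<Rightarrow> (nat \<Rightarrow> real) \<Rightarrow> (nat \<Rightarrow> real) \<Rightarrow> real"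
  where "ip N x y = (\<Sum>i<N. x i * y i)"

definition unit_coord :: "nat \<Rightarrow> nat \<Rightarrow> real"
  where "unit_coord i = (\<lambda>j. if j = i then 1 else 0)"

definition orthonormal_in :: "nat \<Rightarrow> (nat \<Rightarrow> real) set \<Rightarrow> bool"
  where "orthonormal_in N G \<longleftrightarrow> finite G \<and> G \<subseteq> coord_space N \<and>
    (\<forall>g\<in>G. \<forall>h\<in>G. ip N g h = (if g = h then 1 else 0))"

lemma ip_commute: "ip N x y = ip N y x"
  by (simp add: ip_def mult.commute)

lemma ip_add_right: "ip N x (y + z) = ip N x y + ip N x z"
  by (simp add: ip_def algebra_simps sum.distrib)

lemma ip_diff_left: "ip N (x - y) z = ip N x z - ip N y z"
  by (simp add: ip_def algebra_simps sum_subtractf)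

lemma ip_scaleR_right: "ip N x (c *\<^sub>R y) = c * ip N x y"
  by (simp add: ip_def scaleR_fun_def sum_distrib_left algebra_simps)

lemma ip_zero_right: "ip N x 0 = 0"
  by (simp add: ip_def)

lemma ip_sum_right: "ip N x (\<Sum>g\<in>G. c g *\<^sub>R f g) = (\<Sum>g\<in>G. c g * ip N x (f g))"
  by (induction G rule: infinite_finite_induct)
    (simp_all only: sum.infinite sum.empty sum.insert ip_add_right ip_scaleR_right ip_zero_right
      not_False_eq_True)

lemma ip_unit_coord: "i < N \<Longrightarrow> ip N x (unit_coord i) = x i"
  by (simp add: ip_def unit_coord_def if_distrib cong: if_cong)

lemma ip_self: "ip N x x = (\<Sum>i<N. (x i)\<^sup>2)"
  by (simp add: ip_def power2_eq_square)

lemma ip_self_eq_0: "x \<in> coord_space N \<Longrightarrow> ip N x x = 0 \<Longrightarrow> x = 0"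
  by (rule ext) (auto simp: ip_self coord_space_def sum_nonneg_eq_0_iff not_less[symmetric])

lemma unit_coord_in: "i < N \<Longrightarrow> unit_coord i \<in> coord_space N"
  by (simp add: unit_coord_def coord_space_def)

lemma subspace_coord_space: "subspace (coord_space N)"
  by (simp add: subspace_def coord_space_def scaleR_fun_def)

lemma ip_span_eq_0:
  assumes "\<And>g. g \<in> G \<Longrightarrow> ip N x g = 0" "y \<in> span G"
  shows "ip N x y = 0"
  using assms(2)
  by (rule span_induct) (auto simp: assms(1) subspace_def ip_add_right ip_scaleR_right ip_zero_right)

section \<open>Orthogonal projection and Gram-Schmidt\<close>

text \<open>For orthonormal \<open>G\<close> this is the projection of \<open>a\<close> to the
  orthogonal complement of \<open>span G\<close>.\<close>

definition residual :: "nat \<Rightarrow> (nat \<Rightarrow> real) set \<Rightarrow> (nat \<Rightarrow> real) \<Rightarrow> nat \<Rightarrow> real"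
  where "residual N G a = a - (\<Sum>g\<in>G. ip N a g *\<^sub>R g)"

lemma residual_in: "orthonormal_in N G \<Longrightarrow> a \<in> coord_space N \<Longrightarrow> residual N G a \<in> coord_space N"
  unfolding residual_def orthonormal_in_def
  by (intro subspace_diff subspace_sum subspace_scale subspace_coord_space) auto

lemma ip_residual:
  assumes G: "orthonormal_in N G" and h: "h \<in> G"
  shows "ip N (residual N G a) h = 0"
proof -
  have "(\<Sum>g\<in>G. ip N a g * ip N h g) = (\<Sum>g\<in>G. if g = h then ip N a g else 0)"
    using G h by (intro sum.cong) (auto simp: orthonormal_in_def)
  also have "\<dots> = ip N a h"
    using G h by (simp add: orthonormal_in_def)
  finally have "ip N (\<Sum>g\<in>G. ip N a g *\<^sub>R g) h = ip N a h"
    by (subst ip_commute) (simp add: ip_sum_right)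
  then show ?thesis
    by (simp add: residual_def ip_diff_left)
qed

text \<open>Pythagoras: the residual is orthogonal to the part of \<open>a\<close> in
  \<open>span G\<close>.\<close>

lemma ip_residual_self:
  assumes "orthonormal_in N G"
  shows "ip N (residual N G a) (residual N G a) = ip N a a - (\<Sum>g\<in>G. (ip N a g)\<^sup>2)"
proof -
  let ?r = "residual N G a"
  have "ip N ?r (\<Sum>g\<in>G. ip N a g *\<^sub>R g) = 0"
    by (simp add: ip_sum_right ip_residual[OF assms])
  then have "ip N ?r ?r = ip N ?r a"
    using ip_add_right[of N ?r ?r "\<Sum>g\<in>G. ip N a g *\<^sub>R g"] by (simp add: residual_def)
  also have "\<dots> = ip N a a - ip N (\<Sum>g\<in>G. ip N a g *\<^sub>R g) a"
    by (simp only: residual_def ip_diff_left)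
  also have "ip N (\<Sum>g\<in>G. ip N a g *\<^sub>R g) a = ip N a (\<Sum>g\<in>G. ip N a g *\<^sub>R g)"
    by (rule ip_commute)
  finally show ?thesis
    by (simp add: ip_sum_right power2_eq_square)
qed

text \<open>Gram-Schmidt, one vector at a time: the residual of \<open>a\<close> is normalised and
  added, unless it vanishes. Keeping \<open>G\<close> inside \<open>G'\<close> allows further
  constraints to be imposed later, at a cost of at most one vector each.\<close>

lemma orthonormal_extend:
  assumes "finite A" "A \<subseteq> coord_space N" "orthonormal_in N G"
  shows "\<exists>G'. G \<subseteq> G' \<and> orthonormal_in N G' \<and> A \<subseteq> span G' \<and> card G' \<le> card G + card A"
  using assms(1,2)
proof (induction A rule: finite_induct)
  case empty
  then show ?case using assms(3) by auto
next
  case (insert a A)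
  then obtain H where H: "G \<subseteq> H" "orthonormal_in N H" "A \<subseteq> span H" "card H \<le> card G + card A"
    by auto
  define r where "r = residual N H a"
  have r_in: "r \<in> coord_space N"
    using residual_in[OF H(2)] insert.prems by (simp add: r_def)
  have a_eq: "a = r + (\<Sum>g\<in>H. ip N a g *\<^sub>R g)"
    by (simp add: r_def residual_def)
  have sum_in: "(\<Sum>g\<in>H. ip N a g *\<^sub>R g) \<in> span K" if "H \<subseteq> K" for K
    using that by (intro span_sum span_scale span_base) auto
  show ?case
  proof (cases "r = 0")
    case True
    then have "a \<in> span H"
      using sum_in[of H] a_eq by simp
    then show ?thesis
      using H insert.hyps by (intro exI[of _ H]) auto
  next
    case False
    define \<rho> where "\<rho> = sqrt (ip N r r)"
    have "ip N r r \<ge> 0"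
      by (simp add: ip_self sum_nonneg)
    moreover have "ip N r r \<noteq> 0"
      using False ip_self_eq_0 r_in by blast
    ultimately have \<rho>: "\<rho> > 0" "\<rho> * \<rho> = ip N r r"
      by (auto simp: \<rho>_def)
    define h where "h = (1 / \<rho>) *\<^sub>R r"
    have "ip N h h = 1 / \<rho> * (1 / \<rho> * ip N r r)"
      unfolding h_def by (metis ip_commute ip_scaleR_right)
    then have hh: "ip N h h = 1"
      using \<rho> \<open>ip N r r \<noteq> 0\<close> by (simp add: field_simps)
    have hg: "ip N g h = 0" "ip N h g = 0" if "g \<in> H" for g
      using ip_residual[OF H(2) that, of a] by (simp_all add: h_def ip_scaleR_right ip_commute r_def ip_commute[of N _ g])
    have "h \<in> coord_space N"
      using r_in subspace_scale[OF subspace_coord_space] by (simp add: h_def)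
    then have on: "orthonormal_in N (insert h H)"
      using H(2) hh hg unfolding orthonormal_in_def by auto
    have "r = \<rho> *\<^sub>R h"
      using \<rho> by (simp add: h_def)
    then have "r \<in> span (insert h H)"
      by (simp add: span_base span_scale)
    then have "a \<in> span (insert h H)"
      by (subst a_eq) (intro span_add sum_in subset_insertI)
    moreover have "A \<subseteq> span (insert h H)"
      using H(3) span_mono[of H "insert h H"] by auto
    moreover have "card (insert h H) \<le> card G + card (insert a A)"
      using H(2,4) insert.hyps card_insert_le_m1 by (auto simp: orthonormal_in_def card_insert_if)
    ultimately show ?thesis
      using H(1) on by (intro exI[of _ "insert h H"]) auto
  qed
qed

section \<open>Compactness of the feasible set\<close>

text \<open>In the product topology the cube is compact by Tychonoff, and each remaining condition
  is closed, as it involves only finitely many coordinates.\<close>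

lemma compact_orthogonal_cube:
  "compact {z \<in> coord_space N. (\<forall>i. \<bar>z i\<bar> \<le> 1) \<and> (\<forall>g\<in>G. ip N z g = 0)}" (is "compact ?K")
proof -
  have "compactin (product_topology (\<lambda>i::nat. euclidean) UNIV) (PiE UNIV (\<lambda>i. {-1..1::real}))"
    by (subst compactin_PiE) auto
  then have cube: "compact (PiE UNIV (\<lambda>i::nat. {-1..1::real}))"
    by (simp add: euclidean_product_topology)
  have coord: "closed {z::nat \<Rightarrow> real. z i = 0}" for i
    by (intro closed_Collect_eq continuous_on_const continuous_on_coordinatewise_then_product
        continuous_on_product_coordinates)
  have orth: "closed {z::nat \<Rightarrow> real. ip N z g = 0}" for g
    unfolding ip_def
    by (intro closed_Collect_eq continuous_intros continuous_on_product_coordinates)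
  have "?K = PiE UNIV (\<lambda>i. {-1..1}) \<inter> ((\<Inter>i\<in>{N..}. {z. z i = 0}) \<inter> (\<Inter>g\<in>G. {z. ip N z g = 0}))"
    by (auto simp: coord_space_def abs_le_iff PiE_def Pi_def)
  then show ?thesis
    using cube coord orth by (auto intro!: compact_Int_closed closed_Int closed_INT)
qed

section \<open>Leverage scores and the choice of the block\<close>

text \<open>The inner sum is the squared norm of the projection of \<open>unit_coord i\<close> to
  \<open>span G\<close>, its leverage. Summing over \<open>i\<close> gives the trace of this
  projection, which is its rank.\<close>

lemma leverage_sum:
  assumes "orthonormal_in N G"
  shows "(\<Sum>i<N. \<Sum>g\<in>G. (g i)\<^sup>2) = real (card G)"
proof -
  have "(\<Sum>i<N. \<Sum>g\<in>G. (g i)\<^sup>2) = (\<Sum>g\<in>G. ip N g g)"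
    by (subst sum.swap) (simp add: ip_self)
  also have "\<dots> = (\<Sum>g\<in>G. 1)"
    using assms by (intro sum.cong) (auto simp: orthonormal_in_def)
  finally show ?thesis by simp
qed

text \<open>Averaging: the \<open>n\<close> consecutive blocks of length \<open>m\<close> share a
  total leverage of at most \<open>m * n / 2\<close>.\<close>

lemma low_leverage_block:
  assumes "orthonormal_in (m * n) G" "2 * card G \<le> m * n" "n \<ge> 1"
  obtains b where "b \<subseteq> {..<m * n}" "card b = m" "(\<Sum>i\<in>b. \<Sum>g\<in>G. (g i)\<^sup>2) \<le> real m / 2"
proof -
  let ?f = "\<lambda>i. \<Sum>g\<in>G. (g i)\<^sup>2"
  have "\<exists>k<n. sum ?f {k * m..<k * m + m} \<le> real m / 2"
  proof (rule ccontr)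
    assume "\<not> ?thesis"
    then have "(\<Sum>k<n. real m / 2) < (\<Sum>k<n. sum ?f {k * m..<k * m + m})"
      using assms(3) by (intro sum_strict_mono) (auto simp: not_le lessThan_empty_iff)
    also have "\<dots> = real (card G)"
      using leverage_sum[OF assms(1)] by (simp add: sum.nat_group mult.commute)
    also have "\<dots> \<le> real (m * n) / 2"
      using assms(2) by (simp add: field_simps flip: of_nat_mult)
    finally show False by (simp add: mult.commute)
  qed
  then obtain k where k: "k < n" "sum ?f {k * m..<k * m + m} \<le> real m / 2" by blast
  have "k * m + m \<le> m * n"
    using mult_le_mono2[of "Suc k" n m] k(1) by (simp add: algebra_simps)
  then show thesis
    using k(2) by (intro that[of "{k * m..<k * m + m}"]) auto
qed

section \<open>Extremal construction of the dual certificate\<close>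

lemma dual_certificate:
  assumes G: "orthonormal_in N G" and b: "b \<subseteq> {..<N}" "card b = m"
    and lev: "(\<Sum>i\<in>b. \<Sum>g\<in>G. (g i)\<^sup>2) \<le> real m / 2"
  obtains z where "\<And>g. g \<in> G \<Longrightarrow> ip N z g = 0" "\<And>i. \<bar>z i\<bar> \<le> 1"
    "(\<Sum>i<N. (z i)\<^sup>2) \<le> 4 * (\<Sum>i\<in>b. (z i)\<^sup>2)" "(\<Sum>i\<in>b. (z i)\<^sup>2) \<ge> real m / 16"
proof -
  define \<Phi> where "\<Phi> = (\<lambda>z::nat \<Rightarrow> real. 4 * (\<Sum>i\<in>b. (z i)\<^sup>2) - (\<Sum>i<N. (z i)\<^sup>2))"
  define K where "K = {z \<in> coord_space N. (\<forall>i. \<bar>z i\<bar> \<le> 1) \<and> (\<forall>g\<in>G. ip N z g = 0)}"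
  have fb: "finite b"
    using b(1) finite_subset by blast
  have K0: "0 \<in> K"
    by (auto simp: K_def coord_space_def ip_def)
  have compact: "compact K"
    unfolding K_def by (rule compact_orthogonal_cube)
  have "continuous_on K \<Phi>"
    unfolding \<Phi>_def
    by (intro continuous_intros continuous_on_subset[OF continuous_on_product_coordinates]) auto
  then obtain z where z: "z \<in> K" "\<And>y. y \<in> K \<Longrightarrow> \<Phi> y \<le> \<Phi> z"
    using continuous_attains_sup[OF compact] K0 by blast
  have "\<Phi> 0 = 0"
    by (simp add: \<Phi>_def)
  then have mass: "(\<Sum>i<N. (z i)\<^sup>2) \<le> 4 * (\<Sum>i\<in>b. (z i)\<^sup>2)"
    using z(2)[OF K0] by (simp add: \<Phi>_def)
  have z1: "\<bar>z i\<bar> \<le> 1" for i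
    using z(1) by (simp add: K_def)
  have "(\<Sum>i\<in>b. (z i)\<^sup>2) \<ge> real m / 16"
  proof (rule ccontr)
    assume small: "\<not> ?thesis"
    define T where "T = {i. i < N \<and> \<bar>z i\<bar> = 1}"
    have "(z i)\<^sup>2 = 1" if "i \<in> T" for i
      using that abs_square_eq_1[of "z i"] by (simp add: T_def)
    then have "real (card T) = (\<Sum>i\<in>T. (z i)\<^sup>2)"
      by simp
    also have "\<dots> \<le> (\<Sum>i<N. (z i)\<^sup>2)"
      by (rule sum_mono2) (auto simp: T_def)
    \<comment> \<open>The factor 4 of \<open>mass\<close> times the assumed bound
      \<open>m / 16\<close>.\<close>
    finally have cT: "real (card T) < real m / 4"
      using mass small by simp
    have fT: "finite T" by (simp add: T_def)
    \<comment> \<open>With these unit vectors among the constraints, every direction orthogonal to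
      \<open>H\<close> vanishes on \<open>T\<close>, where \<open>z\<close> touches the boundary of
      the cube.\<close>
    have "unit_coord ` T \<subseteq> coord_space N"
      using unit_coord_in by (auto simp: T_def)
    then obtain H where H: "G \<subseteq> H" "orthonormal_in N H" "unit_coord ` T \<subseteq> span H"
        "card H \<le> card G + card (unit_coord ` T)"
      using orthonormal_extend[OF _ _ G, of "unit_coord ` T"] fT by auto
    have fH: "finite H" using H(2) by (simp add: orthonormal_in_def)
    have fG: "finite G" using G by (simp add: orthonormal_in_def)
    have "card H \<le> card G + card T"
      using H(4) card_image_le[OF fT, of unit_coord] by linarith
    then have cHG: "card (H - G) \<le> card T"
      using H(1) fG by (simp add: card_Diff_subset)
    \<comment> \<open>Each of the at most \<open>card T\<close> new vectors has norm 1, so the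
      leverage of \<open>b\<close> grows by less than \<open>m / 4\<close> and its average stays
      below \<open>3 / 4\<close>.\<close>
    have "(\<Sum>i\<in>b. \<Sum>g\<in>H. (g i)\<^sup>2) = (\<Sum>i\<in>b. \<Sum>g\<in>G. (g i)\<^sup>2) + (\<Sum>i\<in>b. \<Sum>g\<in>H - G. (g i)\<^sup>2)"
      by (simp add: sum.subset_diff[OF H(1) fH] add.commute flip: sum.distrib)
    also have "(\<Sum>i\<in>b. \<Sum>g\<in>H - G. (g i)\<^sup>2) = (\<Sum>g\<in>H - G. \<Sum>i\<in>b. (g i)\<^sup>2)"
      by (rule sum.swap)
    also have "\<dots> \<le> (\<Sum>g\<in>H - G. ip N g g)"
      unfolding ip_self using b(1) by (intro sum_mono sum_mono2) auto
    also have "\<dots> = (\<Sum>g\<in>H - G. 1)"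
      using H(2) by (intro sum.cong) (auto simp: orthonormal_in_def)
    finally have "(\<Sum>i\<in>b. \<Sum>g\<in>H. (g i)\<^sup>2) < (\<Sum>i\<in>b. 3 / 4)"
      using lev cHG cT b(2) by simp
    then obtain i where i: "i \<in> b" "(\<Sum>g\<in>H. (g i)\<^sup>2) < 3 / 4"
      by (meson not_le sum_mono)
    have iN: "i < N" using i(1) b(1) by auto
    define w where "w = residual N H (unit_coord i)"
    have w_in: "w \<in> coord_space N"
      using residual_in[OF H(2) unit_coord_in[OF iN]] by (simp add: w_def)
    have wH: "ip N w g = 0" if "g \<in> H" for g
      using ip_residual[OF H(2) that] by (simp add: w_def)
    have wT: "w j = 0" if "j \<in> T" for j
      using ip_span_eq_0[of H N w "unit_coord j"] wH H(3) that ip_unit_coord[of j N w]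
      by (auto simp: T_def)
    define a where "a = 1 - (\<Sum>g\<in>H. (g i)\<^sup>2)"
    have ww: "ip N w w = a"
      using ip_residual_self[OF H(2), of "unit_coord i"]
      unfolding w_def a_def ip_commute[of N "unit_coord i"] ip_unit_coord[OF iN]
      by (simp add: unit_coord_def)
    \<comment> \<open>A projection is self-adjoint and idempotent, so coordinate \<open>i\<close> of
      \<open>w\<close> equals the squared norm of \<open>w\<close>.\<close>
    have wi: "w i = a"
    proof -
      have "ip N w (w + (\<Sum>g\<in>H. ip N (unit_coord i) g *\<^sub>R g)) = ip N w w"
        by (simp add: ip_add_right ip_sum_right wH)
      moreover have "w + (\<Sum>g\<in>H. ip N (unit_coord i) g *\<^sub>R g) = unit_coord i"
        by (simp add: w_def residual_def)
      ultimately have "ip N w (unit_coord i) = ip N w w" by simp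
      then show ?thesis
        using ww iN by (simp add: ip_unit_coord)
    qed
    have a: "a > 1 / 4"
      using i(2) by (simp add: a_def)
    have "(w i)\<^sup>2 \<le> (\<Sum>i\<in>b. (w i)\<^sup>2)"
      using i(1) fb by (intro member_le_sum) auto
    \<comment> \<open>Here the weight 4 in \<open>\<Phi>\<close> meets the leverage bound
      \<open>3 / 4\<close>: coordinate \<open>i\<close> alone outweighs the whole mass
      \<open>a\<close> of \<open>w\<close>.\<close>
    moreover have "a < 4 * a\<^sup>2"
      using a by (simp add: power2_eq_square)
    ultimately have \<Phi>w: "\<Phi> w > 0"
      using ww wi by (simp add: \<Phi>_def ip_self)
    \<comment> \<open>On \<open>T\<close> nothing moves, and each of the finitely many other
      coordinates has slack.\<close>
    have "\<exists>t>0. \<forall>j<N. \<bar>z j\<bar> + t * \<bar>w j\<bar> \<le> 1"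
    proof -
      have "\<forall>\<^sub>F t in at_right 0. \<bar>z j\<bar> + t * \<bar>w j\<bar> \<le> 1" if "j < N" for j
      proof (cases "j \<in> T")
        case True
        then show ?thesis using wT z1 by simp
      next
        case False
        then have "\<bar>z j\<bar> < 1" using z1[of j] that by (simp add: T_def)
        moreover have "((\<lambda>t. \<bar>z j\<bar> + t * \<bar>w j\<bar>) \<longlongrightarrow> \<bar>z j\<bar> + 0 * \<bar>w j\<bar>) (at_right 0)"
          by (intro tendsto_intros)
        ultimately have "\<forall>\<^sub>F t in at_right 0. \<bar>z j\<bar> + t * \<bar>w j\<bar> < 1"
          by (intro order_tendstoD) auto
        then show ?thesis by (rule eventually_mono) simp
      qed
      then have "\<forall>\<^sub>F t in at_right (0::real). \<forall>j\<in>{..<N}. \<bar>z j\<bar> + t * \<bar>w j\<bar> \<le> 1"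
        by (intro eventually_ball_finite) auto
      moreover have "\<forall>\<^sub>F t in at_right (0::real). t > 0"
        by (rule eventually_at_right_less)
      ultimately have "\<forall>\<^sub>F t in at_right (0::real). t > 0 \<and> (\<forall>j\<in>{..<N}. \<bar>z j\<bar> + t * \<bar>w j\<bar> \<le> 1)"
        by eventually_elim auto
      then have "\<exists>t>0. \<forall>j\<in>{..<N}. \<bar>z j\<bar> + t * \<bar>w j\<bar> \<le> 1"
        by (rule eventually_happens'[rotated]) simp
      then show ?thesis by (simp add: Ball_def)
    qed
    then obtain t where t: "t > 0" "\<And>j. j < N \<Longrightarrow> \<bar>z j\<bar> + t * \<bar>w j\<bar> \<le> 1" by blast
    have step: "(\<lambda>j. z j + u * w j) \<in> K" if u: "\<bar>u\<bar> = t" for u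
    proof -
      have "\<bar>z j + u * w j\<bar> \<le> 1" for j
      proof (cases "j < N")
        case True
        have "\<bar>z j + u * w j\<bar> \<le> \<bar>z j\<bar> + t * \<bar>w j\<bar>"
          using abs_triangle_ineq[of "z j" "u * w j"] by (simp add: abs_mult u)
        then show ?thesis using t(2)[OF True] by simp
      next
        case False
        then show ?thesis
          using z1[of j] w_in by (simp add: coord_space_def)
      qed
      moreover have "ip N (\<lambda>j. z j + u * w j) g = ip N z g + u * ip N w g" for g
        by (simp add: ip_def sum.distrib sum_distrib_left algebra_simps)
      ultimately show ?thesis
        using z(1) w_in wH H(1) by (auto simp: K_def coord_space_def)
    qed
    \<comment> \<open>Parallelogram law: the cross terms of the two signs cancel, so
      \<open>\<Phi>\<close> exceeds \<open>\<Phi> z\<close> at one of the two points.\<close>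
    have "(z j + t * w j)\<^sup>2 + (z j + (- t) * w j)\<^sup>2 = 2 * (z j)\<^sup>2 + 2 * t\<^sup>2 * (w j)\<^sup>2" for j
      by (simp add: power2_eq_square algebra_simps)
    then have par: "(\<Sum>j\<in>S. (z j + t * w j)\<^sup>2) + (\<Sum>j\<in>S. (z j + (- t) * w j)\<^sup>2)
        = 2 * (\<Sum>j\<in>S. (z j)\<^sup>2) + 2 * t\<^sup>2 * (\<Sum>j\<in>S. (w j)\<^sup>2)" for S
      by (simp only: sum.distrib[symmetric] sum_distrib_left)
    have "\<Phi> (\<lambda>j. z j + t * w j) + \<Phi> (\<lambda>j. z j + (- t) * w j) = 2 * \<Phi> z + 2 * t\<^sup>2 * \<Phi> w"
      using par[of b] par[of "{..<N}"] unfolding \<Phi>_def by (simp add: algebra_simps)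
    moreover have "2 * t\<^sup>2 * \<Phi> w > 0"
      using t(1) \<Phi>w by simp
    moreover have "\<Phi> (\<lambda>j. z j + t * w j) \<le> \<Phi> z" "\<Phi> (\<lambda>j. z j + (- t) * w j) \<le> \<Phi> z"
      using t(1) by (intro z(2) step; simp)+
    ultimately show False by linarith
  qed
  then show thesis
    using z(1) mass z1 by (intro that[of z]) (auto simp: K_def)
qed

section \<open>Lower bounds for \<open>lp_norm\<close> by duality\<close>

text \<open>
  A Young-type inequality that replaces Hoelder's: with \<open>\<bar>v\<bar> \<le> 1\<close>, one square of \<open>v\<close> serves all
  exponents \<open>q\<close>.
\<close>

lemma mult_le_powr_plus_square:
  fixes u v q t :: real
  assumes "0 \<le> u" "0 \<le> v" "v \<le> 1" "1 \<le> q" "q \<le> 2" "t > 0"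
  shows "u * v \<le> t powr (1 - q) * u powr q + t * v\<^sup>2"
proof (cases "u \<le> t * v")
  case True
  then have "u * v \<le> t * v * v"
    using assms by (intro mult_right_mono) auto
  then show ?thesis
    by (simp add: power2_eq_square add_increasing)
next
  case False
  then have u: "u > 0"
    using assms by (meson le_less_trans mult_nonneg_nonneg not_le less_imp_le)
  \<comment> \<open>For \<open>t \<le> u\<close> use \<open>v \<le> 1\<close> and compare powers
    with exponent \<open>1 - q \<le> 0\<close>; for \<open>u < t\<close> use
    \<open>v < u / t\<close> and exponent \<open>2 - q \<ge> 0\<close>.\<close>
  have "u * v \<le> t powr (1 - q) * u powr q"
  proof (cases "t \<le> u")
    case True
    have "u * v \<le> u powr (1 - q) * u powr q"
      using u assms by (simp add: mult_left_le flip: powr_add)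
    also have "\<dots> \<le> t powr (1 - q) * u powr q"
      using True assms by (intro mult_right_mono powr_mono2') auto
    finally show ?thesis .
  next
    case less: False
    have "u * v \<le> u * (u / t)"
      using u False assms by (intro mult_left_mono) (auto simp: field_simps)
    also have "\<dots> = u powr (2 - q) * u powr q / t"
      using u by (simp flip: powr_add) (simp add: power2_eq_square)
    also have "\<dots> \<le> t powr (2 - q) * u powr q / t"
      using less assms by (intro divide_right_mono mult_right_mono powr_mono2) auto
    also have "\<dots> = t powr (1 - q) * u powr q"
      using assms(6) powr_diff[of t "2 - q" 1] by simp
    finally show ?thesis .
  qed
  then show ?thesis
    using assms(6) by (simp add: add_increasing2)
qed

text \<open>A large pairing with \<open>z\<close> forces a large norm; \<open>w\<close> stands for
  the approximation error \<open>x - y\<close>.\<close>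

lemma lp_norm_ge:
  assumes q: "1 \<le> q" "q \<le> 2"
    and z1: "\<And>i. \<bar>z i\<bar> \<le> 1" and mass: "(\<Sum>i<N. (z i)\<^sup>2) \<le> 4 * s" and s: "s \<ge> real m / 16"
    and pair: "s \<le> ip N w z"
  shows "lp_norm (ereal q) N w \<ge> 1 / 256 * real m powr (1 / q)"
proof -
  define S where "S = (\<Sum>i<N. \<bar>w i\<bar> powr q)"
  have "s \<le> (\<Sum>i<N. \<bar>w i\<bar> * \<bar>z i\<bar>)"
    using pair unfolding ip_def
    by (rule order_trans) (intro sum_mono, metis abs_ge_self abs_mult)
  \<comment> \<open>With weight \<open>1/8\<close> the quadratic term is at most
    \<open>1/8 * 4 * s = s / 2\<close>, which the left side absorbs.\<close>
  also have "\<dots> \<le> (\<Sum>i<N. (1/8) powr (1 - q) * \<bar>w i\<bar> powr q + 1/8 * \<bar>z i\<bar>\<^sup>2)"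
    using z1 q by (intro sum_mono mult_le_powr_plus_square) auto
  also have "\<dots> = (1/8) powr (1 - q) * S + 1/8 * (\<Sum>i<N. (z i)\<^sup>2)"
    by (simp add: S_def sum.distrib sum_distrib_left sum_divide_distrib)
  \<comment> \<open>The factor is largest at \<open>q = 2\<close>, where it is 8.\<close>
  also have "(1/8::real) powr (1 - q) * S \<le> (1/8) powr (- 1) * S"
    using q by (intro mult_right_mono powr_mono') (auto simp: S_def sum_nonneg)
  finally have "s \<le> 8 * S + s / 2"
    using mass by (simp add: powr_minus)
  then have "real m / 256 \<le> S"
    using s by simp
  then have "(real m / 256) powr (1 / q) \<le> S powr (1 / q)"
    using q by (intro powr_mono2) auto
  moreover have "(real m / 256) powr (1 / q) = (1 / 256) powr (1 / q) * real m powr (1 / q)"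
    by (subst powr_mult[symmetric]) auto
  \<comment> \<open>As \<open>1 / q \<le> 1\<close> and the base is below 1, one constant serves all
    \<open>q\<close>.\<close>
  moreover have "(1 / 256 :: real) powr 1 \<le> (1 / 256) powr (1 / q)"
    using q by (intro powr_mono') auto
  then have "1 / 256 * real m powr (1 / q) \<le> (1 / 256) powr (1 / q) * real m powr (1 / q)"
    by (intro mult_right_mono) auto
  ultimately show ?thesis
    by (simp add: lp_norm_def S_def)
qed

section \<open>The far point and the width bound\<close>

text \<open>The certificate \<open>z\<close> is orthogonal to \<open>L\<close>, so it pairs with
  \<open>x - y\<close> as it does with \<open>x\<close>, whatever \<open>y \<in> L\<close> is. The
  point \<open>x\<close> depends on neither \<open>y\<close> nor \<open>q\<close>.\<close>

lemma octahedron_far_point: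
  assumes L: "L \<subseteq> coord_space (m * n)" "finite B" "L = span B" "2 * dim L \<le> m * n"
    and n: "n \<ge> 1"
  shows "\<exists>x\<in>octahedron m (m * n). \<forall>y\<in>L. \<forall>q\<in>{1..2}.
      lp_norm (ereal q) (m * n) (x - y) \<ge> 1 / 256 * real m powr (1 / q)"
proof -
  let ?N = "m * n"
  obtain C where C: "C \<subseteq> L" "independent C" "L \<subseteq> span C" "card C = dim L"
    using basis_exists by blast
  have "finite C"
    using independent_span_bound[OF L(2) C(2)] C(1) L(3) by simp
  then obtain G where G: "orthonormal_in ?N G" "C \<subseteq> span G" "card G \<le> card C"
    using orthonormal_extend[of C ?N "{}"] C(1) L(1) that by (force simp: orthonormal_in_def)
  have LG: "L \<subseteq> span G"
    using C(3) G(2) span_minimal[OF _ subspace_span] by blast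
  have "2 * card G \<le> ?N"
    using G(3) C(4) L(4) by linarith
  from low_leverage_block[OF G(1) this n]
  obtain b where b: "b \<subseteq> {..<?N}" "card b = m" "(\<Sum>i\<in>b. \<Sum>g\<in>G. (g i)\<^sup>2) \<le> real m / 2"
    by blast
  obtain z where z: "\<And>g. g \<in> G \<Longrightarrow> ip ?N z g = 0" "\<And>i. \<bar>z i\<bar> \<le> 1"
      "(\<Sum>i<?N. (z i)\<^sup>2) \<le> 4 * (\<Sum>i\<in>b. (z i)\<^sup>2)" "(\<Sum>i\<in>b. (z i)\<^sup>2) \<ge> real m / 16"
    using dual_certificate[OF G(1) b] by blast
  \<comment> \<open>These signs turn the pairing with \<open>z\<close> into the sum of
    \<open>\<bar>z i\<bar>\<close> over \<open>b\<close>, which dominates the sum of squares because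
    \<open>\<bar>z i\<bar> \<le> 1\<close>.\<close>
  define x where "x = (\<lambda>i. if i \<in> b then sgn (z i) else 0)"
  have restrict: "(\<Sum>i<?N. if i \<in> b then f i else 0) = sum f b" for f :: "nat \<Rightarrow> real"
    using b(1) by (simp add: sum.If_cases Int_absorb1)
  have "(\<Sum>i<?N. \<bar>x i\<bar>) = (\<Sum>i\<in>b. \<bar>sgn (z i)\<bar>)"
    by (subst restrict[symmetric]) (auto simp: x_def intro!: sum.cong)
  also have "\<dots> \<le> (\<Sum>i\<in>b. 1)"
    by (intro sum_mono) (simp add: sgn_if)
  finally have "(\<Sum>i<?N. \<bar>x i\<bar>) \<le> real m"
    using b(2) by simp
  then have x_in: "x \<in> octahedron m ?N"
    using b(1) by (auto simp: octahedron_eq coord_space_def x_def sgn_if)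
  have "ip ?N x z = (\<Sum>i\<in>b. \<bar>z i\<bar>)"
    unfolding ip_def
    by (subst restrict[symmetric]) (auto simp: x_def abs_sgn mult.commute intro!: sum.cong)
  moreover have "(z i)\<^sup>2 \<le> \<bar>z i\<bar>" for i
    using mult_left_mono[OF z(2)[of i], of "\<bar>z i\<bar>"] by (simp add: power2_eq_square flip: abs_mult)
  ultimately have pair: "(\<Sum>i\<in>b. (z i)\<^sup>2) \<le> ip ?N x z"
    by (simp add: sum_mono)
  show ?thesis
  proof (rule bexI[OF _ x_in], intro ballI)
    fix y :: "nat \<Rightarrow> real" and q :: real
    assume y: "y \<in> L" and "q \<in> {1..2}"
    then have q: "1 \<le> q" "q \<le> 2" by auto
    have "ip ?N z y = 0"
      using ip_span_eq_0[of G ?N z y] z(1) y LG by auto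
    then have "(\<Sum>i\<in>b. (z i)\<^sup>2) \<le> ip ?N (x - y) z"
      using pair by (simp add: ip_diff_left ip_commute[of _ y])
    then show "lp_norm (ereal q) ?N (x - y) \<ge> 1 / 256 * real m powr (1 / q)"
      by (rule lp_norm_ge[OF q z(2-4)])
  qed
qed

theorem mainTheorem3:
  "\<exists>c::real. c > 0 \<and>
     (\<forall>(m::nat) (n::nat) (N::nat) (q::real).
        m \<ge> 1 \<longrightarrow> n \<ge> 1 \<longrightarrow> N = m * n \<longrightarrow> q \<in> {1..2} \<longrightarrow>
          kolmogorov_width (nat \<lfloor>real N / 2\<rfloor>) (octahedron m N) (coord_space N) (lp_norm (ereal q) N)
            \<ge> ereal (c * real m powr (1 / q)))"
proof (intro exI[of _ "1 / 256"] conjI allI impI)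
  fix m n N :: nat and q :: real
  assume n: "n \<ge> 1" and N: "N = m * n" and q: "q \<in> {1..2}"
  show "kolmogorov_width (nat \<lfloor>real N / 2\<rfloor>) (octahedron m N) (coord_space N) (lp_norm (ereal q) N)
      \<ge> ereal (1 / 256 * real m powr (1 / q))"
    unfolding kolmogorov_width_def
  \<comment> \<open>For each competing subspace \<open>span B\<close>, one point far from all its
    elements bounds the supremum below.\<close>
  proof (rule INF_greatest, clarify)
    fix B :: "(nat \<Rightarrow> real) set"
    assume L: "span B \<subseteq> coord_space N" "finite B"
      and d: "dim (span B) \<le> nat \<lfloor>real N / 2\<rfloor>"
    have "2 * dim (span B) \<le> m * n"
      using d N by linarith
    from octahedron_far_point[OF L(1)[unfolded N] L(2) refl this n]
    obtain x where x: "x \<in> octahedron m (m * n)"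
      "\<forall>y\<in>span B. \<forall>q\<in>{1..2}.
        lp_norm (ereal q) (m * n) (x - y) \<ge> 1 / 256 * real m powr (1 / q)" ..
    show "ereal (1 / 256 * real m powr (1 / q))
        \<le> (SUP x\<in>octahedron m N. INF y\<in>span B. ereal (lp_norm (ereal q) N (x - y)))"
      unfolding N using x(2) q by (intro SUP_upper2[OF x(1)] INF_greatest) auto
  qed
qed simp

end
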